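(* Let $n\ge1$, $h\ge0$ be integers and let $\mathrm{ALG}$ be a $c$-competitive algorithm for the $h$-RO-SP with $n$ online candidates. Then $\mathrm{ALG}$ is a $c$-competitive algorithm for the $h$-IID-PI with $n$ online variables: for every distribution $F$ on $\mathbb{R}_{\ge0}$, when $\mathrm{ALG}$ is given the training samples $T_1,\dots,T_h$ as history set and $X_1,\dots,X_n$ arrive online in this order, $\mathbb{E}[\mathrm{ALG}]\ge c\,\mathbb{E}[\max\{X_1,\dots,X_n\}]$.
   Context: The random-order secretary problem with a sample of size $h$ ($h$-RO-SP): an adversary picks a set $C$ of $n+h$ candidates with values in $\mathbb{R}_{\ge 0}$ (totally ordered by value, ties broken by a fixed consistent tie-breaker). A subset $H\subseteq C$ of cardinality $h$ is drawn uniformly at random and given to the online player upfront; the candidates of $O=C\setminus H$ are then presented one by one in a uniformly random order; after each arrival the player must irrevocably accept or reject it, and accepting terminates. $\mathrm{ALG}$ is the value of the accepted candidate (0 if none), $\mathrm{OPT}=\max O$; an algorithm is $c$-competitive if $\mathbb{E}[\mathrm{ALG}]\ge c\,\mathbb{E}[\mathrm{OPT}]$ for every $C$, expectation over $H$, the random order, and the algorithm's randomness. The $h$-IID-PI (prophet inequality for i.i.d. random variables from an unknown distribution with $h$ training samples): $T_1,\dots,T_h,X_1,\dots,X_n$ are i.i.d. random variables with an unknown distribution $F$ on $\mathbb{R}_{\ge0}$; the player first sees the realizations of $T_1,\dots,T_h$, then sees $X_1,\dots,X_n$ one by one and must irrevocably accept or reject each upon arrival (accepting terminates), obtaining the accepted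 value (0 if none). An algorithm is $c$-competitive if $\mathbb{E}[\mathrm{ALG}]\ge c\,\mathbb{E}[\max_i X_i]$ for every $F$. *)

theory Defs
  imports "HOL-Probability.Probability" "HOL-Combinatorics.Multiset_Permutations"
begin

text \<open>
  A candidate is a pair of a value and a label. Distinct candidates may have equal values; the
  label orders candidates of equal value, so that candidates are totally ordered
  lexicographically. The player observes values only.
\<close>

type_synonym candidate = "real \<times> nat"

text \<open>
  A randomized player draws a seed \<open>\<omega>\<close> from a probability space \<open>\<Omega>\<close>, independent of the input.
  \<open>A \<omega> H xs\<close> tells whether a player that knows the history values \<open>H\<close> accepts the last entry
  of \<open>xs\<close>, where \<open>xs\<close> lists the values that have arrived so far, all but the last of them rejected.
  The history is a multiset because it is unordered but values may repeat.
\<close>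

type_synonym 's player = "'s \<Rightarrow> real multiset \<Rightarrow> real list \<Rightarrow> bool"

definition payoff :: "'s player \<Rightarrow> 's \<Rightarrow> real multiset \<Rightarrow> real list \<Rightarrow> real" where
  "payoff A \<omega> H xs =
     (if \<exists>k<length xs. A \<omega> H (take (Suc k) xs)
      then xs ! (LEAST k. A \<omega> H (take (Suc k) xs))
      else 0)"

text \<open>
  Measurability of the decisions is what gives the expected payoff a meaning when values are
  drawn from an arbitrary distribution.
\<close>

definition online_algorithm :: "nat \<Rightarrow> nat \<Rightarrow> 's measure \<Rightarrow> 's player \<Rightarrow> bool" where
  "online_algorithm h n \<Omega> A \<longleftrightarrow>
     prob_space \<Omega> \<and>
     (\<forall>k\<in>{1..n}. Measurable.pred
        (\<Omega> \<Otimes>\<^sub>M (\<Pi>\<^sub>M i\<in>{..<h}. borel) \<Otimes>\<^sub>M (\<Pi>\<^sub>M i\<in>{..<k}. borel))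
        (\<lambda>(\<omega>, t, x). A \<omega> (mset (map t [0..<h])) (map x [0..<k])))"


subsection \<open>The random-order secretary problem with a sample\<close>

definition ro_sp_instance :: "nat \<Rightarrow> nat \<Rightarrow> candidate set \<Rightarrow> bool" where
  "ro_sp_instance h n C \<longleftrightarrow> finite C \<and> card C = n + h \<and> (\<forall>x\<in>C. 0 \<le> fst x)"

definition history_pmf :: "nat \<Rightarrow> candidate set \<Rightarrow> candidate set pmf" where
  "history_pmf h C = pmf_of_set {H. H \<subseteq> C \<and> card H = h}"

definition ro_sp_alg :: "nat \<Rightarrow> candidate set \<Rightarrow> 's measure \<Rightarrow> 's player \<Rightarrow> ennreal" where
  "ro_sp_alg h C \<Omega> A =
     (\<integral>\<^sup>+\<omega>. (\<integral>\<^sup>+H. (\<integral>\<^sup>+xs.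
         ennreal (payoff A \<omega> (image_mset fst (mset_set H)) (map fst xs))
       \<partial>measure_pmf (pmf_of_set (permutations_of_set (C - H))))
       \<partial>measure_pmf (history_pmf h C)) \<partial>\<Omega>)"

text \<open>
  The label only decides which of several candidates of maximal value is the best one, so the
  value of the best candidate is the maximum of the values.
\<close>

definition ro_sp_opt :: "nat \<Rightarrow> candidate set \<Rightarrow> ennreal" where
  "ro_sp_opt h C = (\<integral>\<^sup>+H. ennreal (Max (fst ` (C - H))) \<partial>measure_pmf (history_pmf h C))"

definition ro_sp_competitive :: "nat \<Rightarrow> nat \<Rightarrow> real \<Rightarrow> 's measure \<Rightarrow> 's player \<Rightarrow> bool" where
  "ro_sp_competitive h n c \<Omega> A \<longleftrightarrow>
     (\<forall>C. ro_sp_instance h n C \<longrightarrow> ro_sp_alg h C \<Omega> A \<ge> ennreal c * ro_sp_opt h C)"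


subsection \<open>The i.i.d. prophet inequality with training samples\<close>

definition nonneg_distribution :: "real measure \<Rightarrow> bool" where
  "nonneg_distribution F \<longleftrightarrow> prob_space F \<and> sets F = sets borel \<and> (AE x in F. 0 \<le> x)"

definition iid_pi_instance ::
  "nat \<Rightarrow> nat \<Rightarrow> real measure \<Rightarrow> 'm measure \<Rightarrow> (nat \<Rightarrow> 'm \<Rightarrow> real) \<Rightarrow> (nat \<Rightarrow> 'm \<Rightarrow> real) \<Rightarrow> bool" where
  "iid_pi_instance h n F M T X \<longleftrightarrow>
     prob_space M \<and>
     prob_space.indep_vars M (\<lambda>_. borel) (case_sum T X) ({..<h} <+> {..<n}) \<and>
     (\<forall>i<h. distr M borel (T i) = F) \<and>
     (\<forall>i<n. distr M borel (X i) = F)"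

definition iid_pi_alg ::
  "nat \<Rightarrow> nat \<Rightarrow> 'm measure \<Rightarrow> (nat \<Rightarrow> 'm \<Rightarrow> real) \<Rightarrow> (nat \<Rightarrow> 'm \<Rightarrow> real) \<Rightarrow>
   's measure \<Rightarrow> 's player \<Rightarrow> ennreal" where
  "iid_pi_alg h n M T X \<Omega> A =
     (\<integral>\<^sup>+\<omega>. (\<integral>\<^sup>+z.
         ennreal (payoff A \<omega> (mset (map (\<lambda>i. T i z) [0..<h])) (map (\<lambda>i. X i z) [0..<n]))
       \<partial>M) \<partial>\<Omega>)"

definition iid_pi_opt :: "nat \<Rightarrow> 'm measure \<Rightarrow> (nat \<Rightarrow> 'm \<Rightarrow> real) \<Rightarrow> ennreal" where
  "iid_pi_opt n M X = (\<integral>\<^sup>+z. ennreal (Max ((\<lambda>i. X i z) ` {..<n})) \<partial>M)"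

text \<open>
  The type argument is the sample space on which the random variables live; it is left arbitrary.
  Expectations are extended nonnegative reals, since \<open>F\<close> need not have a finite mean.
\<close>

definition iid_pi_competitive ::
  "'m itself \<Rightarrow> nat \<Rightarrow> nat \<Rightarrow> real \<Rightarrow> 's measure \<Rightarrow> 's player \<Rightarrow> bool" where
  "iid_pi_competitive (_ :: 'm itself) h n c \<Omega> A \<longleftrightarrow>
     (\<forall>F (M :: 'm measure) T X.
        nonneg_distribution F \<longrightarrow> iid_pi_instance h n F M T X \<longrightarrow>
        iid_pi_alg h n M T X \<Omega> A \<ge> ennreal c * iid_pi_opt n M X)"

end

theory Submission imports Defs begin

text \<open>
  Draw \<open>n + h\<close> i.i.d. values \<open>z\<close> and let the candidates be the pairs \<open>(z i, i)\<close>. For each outcome \<open>z\<close>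
  this is an instance of the secretary problem, so its competitiveness inequality can be integrated
  over \<open>z\<close>. An i.i.d. family is exchangeable: for every choice of the history set and the arrival
  order, the expectation over \<open>z\<close> is already that of the prophet inequality. Averaging
  over the choices is then trivial, and no counting is needed.
\<close>

section \<open>Measurability of the payoff\<close>

text \<open>The index of the accepted value is the least element of a sequence of measurable events,
  and reading the value at that index is a countable case distinction. Seed, history and arrivals
  are arbitrary measurable maps on \<open>N\<close>, so that the lemma covers joint measurability as
  well as the cases where only the seed or only the values vary.\<close>

lemma payoff_measurable:
  assumes "online_algorithm h n \<Omega> A"
    and s: "s \<in> measurable N \<Omega>"
    and t: "\<And>i. i < h \<Longrightarrow> t i \<in> borel_measurable N"
    and x: "\<And>i. i < n \<Longrightarrow> x i \<in> borel_measurable N"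
  shows "(\<lambda>w. payoff A (s w) (mset (map (\<lambda>i. t i w) [0..<h])) (map (\<lambda>i. x i w) [0..<n]))
           \<in> borel_measurable N"
proof -
  define acc where
    "acc k w \<longleftrightarrow> A (s w) (mset (map (\<lambda>i. t i w) [0..<h])) (take (Suc k) (map (\<lambda>i. x i w) [0..<n]))"
    for k w
  \<comment> \<open>The bound \<open>k < n\<close> makes the event empty beyond the last arrival,
    hence measurable for every \<open>k\<close>; \<open>online_algorithm\<close> speaks about
    prefixes of length \<open>1\<close> to \<open>n\<close> only.\<close>
  define first where "first w = (LEAST k. k < n \<and> acc k w)" for w
  have acc: "Measurable.pred N (acc k)" if k: "k < n" for k
  proof -
    have A: "Measurable.pred
        (\<Omega> \<Otimes>\<^sub>M (\<Pi>\<^sub>M i\<in>{..<h}. borel) \<Otimes>\<^sub>M (\<Pi>\<^sub>M i\<in>{..<Suc k}. borel))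
        (\<lambda>(\<omega>, t, x). A \<omega> (mset (map t [0..<h])) (map x [0..<Suc k]))"
    proof -
      have "Suc k \<in> {1..n}" using k by simp
      then show ?thesis using assms(1) unfolding online_algorithm_def by blast
    qed
    \<comment> \<open>Points of a product space are restricted functions. The player reads
      coordinates inside the index ranges, where restriction changes nothing.\<close>
    have "(\<lambda>w. (s w, \<lambda>i\<in>{..<h}. t i w, \<lambda>i\<in>{..<Suc k}. x i w)) \<in>
        measurable N (\<Omega> \<Otimes>\<^sub>M (\<Pi>\<^sub>M i\<in>{..<h}. borel) \<Otimes>\<^sub>M (\<Pi>\<^sub>M i\<in>{..<Suc k}. borel))"
      using k by (intro measurable_Pair s measurable_restrict t x) auto
    from measurable_compose[OF this A]
    have "Measurable.pred N (\<lambda>w. A (s w) (mset (map (\<lambda>i\<in>{..<h}. t i w) [0..<h]))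
        (map (\<lambda>i\<in>{..<Suc k}. x i w) [0..<Suc k]))"
      by (simp only: prod.case)
    also have "(\<lambda>w. A (s w) (mset (map (\<lambda>i\<in>{..<h}. t i w) [0..<h]))
        (map (\<lambda>i\<in>{..<Suc k}. x i w) [0..<Suc k])) = acc k"
    proof
      fix w
      have "map (\<lambda>i\<in>{..<h}. t i w) [0..<h] = map (\<lambda>i. t i w) [0..<h]"
        by (rule map_cong) auto
      moreover have "map (\<lambda>i\<in>{..<Suc k}. x i w) [0..<Suc k] = take (Suc k) (map (\<lambda>i. x i w) [0..<n])"
        using k by (intro nth_equalityI) (auto simp del: upt_Suc)
      ultimately show "A (s w) (mset (map (\<lambda>i\<in>{..<h}. t i w) [0..<h]))
          (map (\<lambda>i\<in>{..<Suc k}. x i w) [0..<Suc k]) = acc k w"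
        unfolding acc_def by (simp only:)
    qed
    finally show ?thesis .
  qed
  have acc': "Measurable.pred N (\<lambda>w. k < n \<and> acc k w)" for k
    using acc[of k] by (cases "k < n") simp_all
  have first_meas: "first \<in> measurable N (count_space UNIV)"
    unfolding first_def by (rule measurable_Least[OF acc'])
  \<comment> \<open>If nothing is accepted, \<open>first w\<close> is unspecified. The guard gives a
    measurable function for every possible index, including those where \<open>x\<close> is not
    known to be measurable.\<close>
  have sel: "(\<lambda>w. if first w < n then x (first w) w else 0) \<in> borel_measurable N"
  proof (rule measurable_compose_countable[where g = first and f = "\<lambda>i w. if i < n then x i w else 0"])
    show "(\<lambda>w. if i < n then x i w else 0) \<in> borel_measurable N" for i
      using x[of i] by (cases "i < n") simp_all
  qed (rule first_meas)
  have first: "first w < n" "(LEAST k. acc k w) = first w" if ex: "\<exists>k<n. acc k w" for w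
  proof -
    have *: "first w < n \<and> acc (first w) w"
      unfolding first_def using LeastI_ex[OF ex] .
    then show "first w < n" by blast
    show "(LEAST k. acc k w) = first w"
    proof (rule Least_equality)
      show "acc (first w) w" using * by blast
      show "first w \<le> j" if "acc j w" for j
      proof (cases "j < n")
        case True
        with that show ?thesis unfolding first_def by (intro Least_le conjI)
      qed (use * in linarith)
    qed
  qed
  have "payoff A (s w) (mset (map (\<lambda>i. t i w) [0..<h])) (map (\<lambda>i. x i w) [0..<n]) =
      (if \<exists>k<n. acc k w then map (\<lambda>i. x i w) [0..<n] ! (LEAST k. acc k w) else 0)" for w
    unfolding payoff_def acc_def length_map length_upt diff_zero by (rule refl)
  moreover have "(if \<exists>k<n. acc k w then map (\<lambda>i. x i w) [0..<n] ! (LEAST k. acc k w) else 0) =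
      (if \<exists>k<n. acc k w then (if first w < n then x (first w) w else 0) else 0)" for w
    using first[of w] by auto
  moreover have "(\<lambda>w. if \<exists>k<n. acc k w then (if first w < n then x (first w) w else 0) else 0)
      \<in> borel_measurable N"
    by (rule measurable_If[OF sel measurable_const predE[OF pred_intros_countable(2)[OF acc']]]) simp
  ultimately show ?thesis by (simp only:)
qed

section \<open>The joint law of history set and arrival order\<close>

text \<open>Both random choices form a single finitely supported law. It is polymorphic so that it
  can be used for candidates and for bare indices alike.\<close>

definition arrival_pmf :: "nat \<Rightarrow> 'a set \<Rightarrow> ('a set \<times> 'a list) pmf" where
  "arrival_pmf h C = bind_pmf (pmf_of_set {H. H \<subseteq> C \<and> card H = h})
     (\<lambda>H. map_pmf (Pair H) (pmf_of_set (permutations_of_set (C - H))))"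

lemma card_subsets_nonempty:
  assumes "h \<le> card C"
  shows "{H. H \<subseteq> C \<and> card H = h} \<noteq> {}"
  using obtain_subset_with_card_n[OF assms] by blast

lemma set_arrival_pmf:
  assumes "finite C" "h \<le> card C"
  shows "set_pmf (arrival_pmf h C) =
    (SIGMA H:{H. H \<subseteq> C \<and> card H = h}. permutations_of_set (C - H))"
  using assms card_subsets_nonempty[OF assms(2)]
  by (auto simp: arrival_pmf_def set_pmf_of_set)

text \<open>An injection induces bijections between the \<open>h\<close>-subsets and between the
  orderings of the complements, and a bijection carries a uniform law to a uniform law. This allows
  the random choices to be made on indices instead of candidates.\<close>

lemma arrival_pmf_image:
  assumes C: "finite C" "h \<le> card C" and f: "inj_on f C"
  shows "arrival_pmf h (f ` C) = map_pmf (map_prod (image f) (map f)) (arrival_pmf h C)"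
proof -
  let ?S = "{H. H \<subseteq> C \<and> card H = h}"
  have "{H. H \<subseteq> f ` C \<and> card H = h} = image f ` ?S"
  proof (intro set_eqI iffI)
    fix H assume H: "H \<in> {H. H \<subseteq> f ` C \<and> card H = h}"
    then obtain G where "G \<subseteq> C" "H = f ` G" by (auto simp: subset_image_iff)
    moreover have "card G = h"
      using H calculation card_image[OF inj_on_subset[OF f]] by simp
    ultimately show "H \<in> image f ` ?S" by blast
  qed (use card_image[OF inj_on_subset[OF f]] in auto)
  moreover have "inj_on (image f) ?S"
    by (rule inj_on_subset[OF inj_on_image_Pow[OF f]]) auto
  ultimately have 1: "pmf_of_set {H. H \<subseteq> f ` C \<and> card H = h} = map_pmf (image f) (pmf_of_set ?S)"
    using C card_subsets_nonempty[OF C(2)] by (simp add: map_pmf_of_set_inj)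
  have 2: "pmf_of_set (permutations_of_set (f ` C - f ` H)) =
      map_pmf (map f) (pmf_of_set (permutations_of_set (C - H)))" if "H \<in> ?S" for H
  proof -
    have "f ` C - f ` H = f ` (C - H)"
      using that by (intro inj_on_image_set_diff[OF f, symmetric]) auto
    moreover have "inj_on (map f) (permutations_of_set (C - H))"
      by (intro inj_on_mapI inj_on_subset[OF f]) (auto simp: permutations_of_set_def)
    moreover have "inj_on f (C - H)"
      using f by (rule inj_on_subset) auto
    ultimately show ?thesis
      using C by (simp add: permutations_of_set_image_inj map_pmf_of_set_inj)
  qed
  show ?thesis
    unfolding arrival_pmf_def 1 bind_map_pmf map_bind_pmf
    using C card_subsets_nonempty[OF C(2)]
    by (intro bind_pmf_cong refl) (simp add: 2 set_pmf_of_set pmf.map_comp o_def)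
qed

lemma ro_sp_alg_arrival_pmf:
  "ro_sp_alg h C \<Omega> A = (\<integral>\<^sup>+\<omega>. (\<integral>\<^sup>+(H, xs).
     ennreal (payoff A \<omega> (image_mset fst (mset_set H)) (map fst xs)) \<partial>arrival_pmf h C) \<partial>\<Omega>)"
  by (simp add: ro_sp_alg_def arrival_pmf_def history_pmf_def)

text \<open>All orderings of \<open>C - H\<close> have the same maximum, so the additional average
  over \<open>xs\<close> is that of a constant. The optimum is thereby expressed under the same law
  as the payoff.\<close>

lemma ro_sp_opt_arrival_pmf:
  assumes "finite C" "h \<le> card C"
  shows "ro_sp_opt h C = (\<integral>\<^sup>+(H, xs). ennreal (Max (set (map fst xs))) \<partial>arrival_pmf h C)"
proof -
  have "(\<integral>\<^sup>+xs. ennreal (Max (set (map fst xs))) \<partial>pmf_of_set (permutations_of_set (C - H))) =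
      ennreal (Max (fst ` (C - H)))" for H
  proof -
    have "set_pmf (pmf_of_set (permutations_of_set (C - H))) = permutations_of_set (C - H)"
      using assms by (intro set_pmf_of_set) auto
    then have "(\<integral>\<^sup>+xs. ennreal (Max (set (map fst xs))) \<partial>pmf_of_set (permutations_of_set (C - H))) =
      (\<integral>\<^sup>+xs. ennreal (Max (fst ` (C - H))) \<partial>pmf_of_set (permutations_of_set (C - H)))"
      by (intro nn_integral_cong_AE) (auto simp: AE_measure_pmf_iff dest: permutations_of_setD)
    then show ?thesis by simp
  qed
  then show ?thesis
    by (simp add: ro_sp_opt_def arrival_pmf_def history_pmf_def)
qed

section \<open>Exchangeability of i.i.d. values\<close>

text \<open>An integral against a finitely supported law is a finite weighted sum, so the exchange
  is linearity of the integral over \<open>M\<close>.\<close>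

lemma nn_integral_pmf_swap:
  fixes f :: "'a \<Rightarrow> 'b \<Rightarrow> ennreal"
  assumes "finite (set_pmf p)" "\<And>x. x \<in> set_pmf p \<Longrightarrow> f x \<in> borel_measurable M"
  shows "(\<integral>\<^sup>+y. (\<integral>\<^sup>+x. f x y \<partial>measure_pmf p) \<partial>M) = (\<integral>\<^sup>+x. (\<integral>\<^sup>+y. f x y \<partial>M) \<partial>measure_pmf p)"
  using assms
  by (simp add: nn_integral_measure_pmf_finite nn_integral_sum nn_integral_multc)

text \<open>\<open>Inl i\<close> is the place of the \<open>i\<close>-th training sample and
  \<open>Inr i\<close> that of the \<open>i\<close>-th arrival, as in the index set of
  \<open>iid_pi_instance\<close>.\<close>

abbreviation slots :: "nat \<Rightarrow> nat \<Rightarrow> (nat + nat) set" where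
  "slots h n \<equiv> {..<h} <+> {..<n}"

text \<open>Encodes an outcome of the random choices as an assignment of elements to slots. The
  history is unordered, so any enumeration of \<open>H\<close> serves for the \<open>Inl\<close>
  slots.\<close>

lemma arrival_bij:
  assumes "finite C" "card C = n + h" "(H, xs) \<in> set_pmf (arrival_pmf h C)"
  obtains \<sigma> where "bij_betw \<sigma> (slots h n) C"
    "mset_set H = mset (map (\<lambda>i. \<sigma> (Inl i)) [0..<h])"
    "xs = map (\<lambda>i. \<sigma> (Inr i)) [0..<n]"
proof -
  have H: "H \<subseteq> C" "card H = h" and xs: "distinct xs" "set xs = C - H"
    using assms by (auto simp: set_arrival_pmf permutations_of_set_def)
  obtain hs where hs: "set hs = H" "distinct hs"
    using finite_distinct_list finite_subset[OF H(1) assms(1)] by blast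
  have lh: "length hs = h" using hs H distinct_card by fastforce
  have ln: "length xs = n"
    using distinct_card[OF xs(1)] xs H assms card_Diff_subset[OF finite_subset[OF H(1) assms(1)] H(1)] by simp
  define \<sigma> where "\<sigma> = case_sum (nth hs) (nth xs)"
  have hs_eq: "map (\<lambda>i. \<sigma> (Inl i)) [0..<h] = hs" and xs_eq: "map (\<lambda>i. \<sigma> (Inr i)) [0..<n] = xs"
    using map_nth[of hs] map_nth[of xs] lh ln by (simp_all add: \<sigma>_def)
  have "bij_betw (nth hs) {..<h} H" "bij_betw (nth xs) {..<n} (C - H)"
    using hs xs lh ln by (auto intro!: bij_betw_nth)
  then have "bij_betw \<sigma> (Inl ` {..<h}) H" "bij_betw \<sigma> (Inr ` {..<n}) (C - H)"
    by (auto simp: bij_betw_def inj_on_def \<sigma>_def image_image)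
  then have "bij_betw \<sigma> (slots h n) (H \<union> (C - H))"
    unfolding Plus_def by (rule bij_betw_combine) auto
  then have "bij_betw \<sigma> (slots h n) C"
    using H(1) by (simp add: Un_absorb1)
  moreover have "mset_set H = mset (map (\<lambda>i. \<sigma> (Inl i)) [0..<h])"
    unfolding hs_eq using mset_set_set[OF hs(2)] hs(1) by simp
  moreover note xs_eq[symmetric]
  ultimately show ?thesis using that by blast
qed

text \<open>Reindexing along the bijection from slots to \<open>C\<close> preserves a product of
  identical factors, and it turns the given history and arrival order into the fixed slots. Hence
  the integral does not depend on \<open>(H, xs)\<close>. The function \<open>f\<close> is general
  because both the maximum and the seed-averaged payoff are inserted later.\<close>

lemma nn_integral_arrival_iid:
  fixes f :: "'b multiset \<Rightarrow> 'b list \<Rightarrow> ennreal"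
  assumes F: "prob_space F" and C: "finite C" "card C = n + h"
    and H: "(H, xs) \<in> set_pmf (arrival_pmf h C)"
    and f: "(\<lambda>y. f (mset (map (\<lambda>i. y (Inl i)) [0..<h])) (map (\<lambda>i. y (Inr i)) [0..<n]))
      \<in> borel_measurable (Pi\<^sub>M (slots h n) (\<lambda>_. F))" (is "?g \<in> _")
  shows "(\<lambda>z. f (image_mset z (mset_set H)) (map z xs)) \<in> borel_measurable (Pi\<^sub>M C (\<lambda>_. F))"
    and "(\<integral>\<^sup>+z. f (image_mset z (mset_set H)) (map z xs) \<partial>Pi\<^sub>M C (\<lambda>_. F)) =
      (\<integral>\<^sup>+y. f (mset (map (\<lambda>i. y (Inl i)) [0..<h])) (map (\<lambda>i. y (Inr i)) [0..<n])
        \<partial>Pi\<^sub>M (slots h n) (\<lambda>_. F))"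
proof -
  obtain \<sigma> where \<sigma>: "bij_betw \<sigma> (slots h n) C"
    "mset_set H = mset (map (\<lambda>i. \<sigma> (Inl i)) [0..<h])"
    "xs = map (\<lambda>i. \<sigma> (Inr i)) [0..<n]"
    using arrival_bij[OF C H] .
  let ?r = "\<lambda>z. \<lambda>j\<in>slots h n. z (\<sigma> j)"
  have fr: "f (image_mset z (mset_set H)) (map z xs) = ?g (?r z)" for z
  proof -
    have "map (\<lambda>i. ?r z (Inl i)) [0..<h] = map (\<lambda>i. z (\<sigma> (Inl i))) [0..<h]"
      "map (\<lambda>i. ?r z (Inr i)) [0..<n] = map (\<lambda>i. z (\<sigma> (Inr i))) [0..<n]"
      by auto
    then show ?thesis
      by (simp add: \<sigma> multiset.map_comp o_def flip: mset_map del: map_eq_conv)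
  qed
  have r: "?r \<in> measurable (Pi\<^sub>M C (\<lambda>_. F)) (Pi\<^sub>M (slots h n) (\<lambda>_. F))"
    using \<sigma>(1) by (intro measurable_restrict measurable_component_singleton) (auto simp: bij_betw_def)
  show "(\<lambda>z. f (image_mset z (mset_set H)) (map z xs)) \<in> borel_measurable (Pi\<^sub>M C (\<lambda>_. F))"
    unfolding fr by (rule measurable_compose[OF r f])
  \<comment> \<open>This is the exchangeability: the coordinates permuted by \<open>\<sigma>\<close>
    have the same joint law because every factor is \<open>F\<close>.\<close>
  have "distr (Pi\<^sub>M C (\<lambda>_. F)) (Pi\<^sub>M (slots h n) (\<lambda>_. F)) ?r = Pi\<^sub>M (slots h n) (\<lambda>_. F)"
    using distr_PiM_reindex[of C "\<lambda>_. F" \<sigma> "slots h n"] F \<sigma>(1) by (auto simp: bij_betw_def)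
  then have "(\<integral>\<^sup>+y. ?g y \<partial>Pi\<^sub>M (slots h n) (\<lambda>_. F)) =
      (\<integral>\<^sup>+y. ?g y \<partial>distr (Pi\<^sub>M C (\<lambda>_. F)) (Pi\<^sub>M (slots h n) (\<lambda>_. F)) ?r)"
    by simp
  also have "\<dots> = (\<integral>\<^sup>+z. f (image_mset z (mset_set H)) (map z xs) \<partial>Pi\<^sub>M C (\<lambda>_. F))"
    unfolding fr by (rule nn_integral_distr[OF r]) (unfold measurable_distr_eq1, rule f)
  finally show "(\<integral>\<^sup>+z. f (image_mset z (mset_set H)) (map z xs) \<partial>Pi\<^sub>M C (\<lambda>_. F)) =
      (\<integral>\<^sup>+y. ?g y \<partial>Pi\<^sub>M (slots h n) (\<lambda>_. F))" ..
qed

text \<open>After exchanging the two integrals, the inner one has the same value \<open>?E\<close>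
  for each outcome in the support, and the average of a constant under a probability law is that
  constant.\<close>

lemma nn_integral_average_arrival_iid:
  fixes f :: "'b multiset \<Rightarrow> 'b list \<Rightarrow> ennreal"
  assumes F: "prob_space F" and C: "finite C" "card C = n + h"
    and f: "(\<lambda>y. f (mset (map (\<lambda>i. y (Inl i)) [0..<h])) (map (\<lambda>i. y (Inr i)) [0..<n]))
      \<in> borel_measurable (Pi\<^sub>M (slots h n) (\<lambda>_. F))"
  shows "(\<lambda>z. \<integral>\<^sup>+(H, xs). f (image_mset z (mset_set H)) (map z xs) \<partial>arrival_pmf h C)
      \<in> borel_measurable (Pi\<^sub>M C (\<lambda>_. F))"
    and "(\<integral>\<^sup>+z. (\<integral>\<^sup>+(H, xs). f (image_mset z (mset_set H)) (map z xs) \<partial>arrival_pmf h C)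
      \<partial>Pi\<^sub>M C (\<lambda>_. F)) =
      (\<integral>\<^sup>+y. f (mset (map (\<lambda>i. y (Inl i)) [0..<h])) (map (\<lambda>i. y (Inr i)) [0..<n])
        \<partial>Pi\<^sub>M (slots h n) (\<lambda>_. F))" (is "_ = ?E")
proof -
  note N = nn_integral_arrival_iid[OF F C _ f]
  have meas: "(\<lambda>z. f (image_mset z (mset_set (fst a))) (map z (snd a))) \<in> borel_measurable (Pi\<^sub>M C (\<lambda>_. F))"
    if "a \<in> set_pmf (arrival_pmf h C)" for a
    using that by (intro N(1)) simp
  have fin: "finite (set_pmf (arrival_pmf h C))"
    using C by (simp add: set_arrival_pmf)
  show "(\<lambda>z. \<integral>\<^sup>+(H, xs). f (image_mset z (mset_set H)) (map z xs) \<partial>arrival_pmf h C)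
      \<in> borel_measurable (Pi\<^sub>M C (\<lambda>_. F))"
    unfolding case_prod_beta nn_integral_measure_pmf_finite[OF fin zero_le]
    by (intro borel_measurable_sum borel_measurable_times_ennreal borel_measurable_const meas)
  have "(\<integral>\<^sup>+z. (\<integral>\<^sup>+(H, xs). f (image_mset z (mset_set H)) (map z xs) \<partial>arrival_pmf h C)
      \<partial>Pi\<^sub>M C (\<lambda>_. F)) =
      (\<integral>\<^sup>+(H, xs). (\<integral>\<^sup>+z. f (image_mset z (mset_set H)) (map z xs) \<partial>Pi\<^sub>M C (\<lambda>_. F))
        \<partial>arrival_pmf h C)"
    unfolding case_prod_beta by (intro nn_integral_pmf_swap fin meas)
  also have "\<dots> = (\<integral>\<^sup>+_. ?E \<partial>arrival_pmf h C)"
    using N(2) by (intro nn_integral_cong_AE) (auto simp: AE_measure_pmf_iff)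
  finally show "(\<integral>\<^sup>+z. (\<integral>\<^sup>+(H, xs). f (image_mset z (mset_set H)) (map z xs) \<partial>arrival_pmf h C)
      \<partial>Pi\<^sub>M C (\<lambda>_. F)) = ?E"
    by simp
qed

section \<open>From random order to the product measure\<close>

text \<open>The candidate set depends on the values \<open>z\<close>. Pulling the inequality back to
  the index set \<open>C\<close> makes the law of the random choices independent of
  \<open>z\<close>, so that it can be integrated over \<open>z\<close>.\<close>

lemma ro_sp_competitiveD:
  fixes z :: "nat \<Rightarrow> real"
  assumes comp: "ro_sp_competitive h n c \<Omega> A" and C: "finite C" "card C = n + h"
    and z: "\<And>i. i \<in> C \<Longrightarrow> 0 \<le> z i"
  shows "ennreal c * (\<integral>\<^sup>+(H, xs). ennreal (Max (set (map z xs))) \<partial>arrival_pmf h C) \<le>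
    (\<integral>\<^sup>+\<omega>. (\<integral>\<^sup>+(H, xs).
      ennreal (payoff A \<omega> (image_mset z (mset_set H)) (map z xs)) \<partial>arrival_pmf h C) \<partial>\<Omega>)"
proof -
  \<comment> \<open>The index serves as label, so \<open>f\<close> is injective even if values
    coincide, as they may for a distribution with atoms.\<close>
  define f where "f i = (z i, i)" for i
  have inj: "inj_on f D" for D by (auto simp: f_def inj_on_def)
  have fst_f: "fst \<circ> f = z" "\<And>i. fst (f i) = z i" by (auto simp: f_def)
  have C': "finite (f ` C)" "card (f ` C) = n + h"
    using C by (simp_all add: card_image[OF inj])
  have "ro_sp_instance h n (f ` C)"
    using C' z by (auto simp: ro_sp_instance_def f_def)
  then have "ennreal c * ro_sp_opt h (f ` C) \<le> ro_sp_alg h (f ` C) \<Omega> A"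
    using comp by (auto simp: ro_sp_competitive_def)
  moreover have "ro_sp_opt h (f ` C) =
      (\<integral>\<^sup>+(H, xs). ennreal (Max (set (map z xs))) \<partial>arrival_pmf h C)"
    using C C' by (simp add: ro_sp_opt_arrival_pmf arrival_pmf_image[OF _ _ inj] case_prod_beta'
        image_image fst_f)
  moreover have "ro_sp_alg h (f ` C) \<Omega> A = (\<integral>\<^sup>+\<omega>. (\<integral>\<^sup>+(H, xs).
      ennreal (payoff A \<omega> (image_mset z (mset_set H)) (map z xs)) \<partial>arrival_pmf h C) \<partial>\<Omega>)"
    using C by (simp add: ro_sp_alg_arrival_pmf arrival_pmf_image[OF _ _ inj] case_prod_beta'
        image_mset_mset_set[OF inj, symmetric] multiset.map_comp fst_f)
  ultimately show ?thesis by simp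
qed

lemma ro_sp_competitive_imp_iid:
  assumes alg: "online_algorithm h n \<Omega> A" and comp: "ro_sp_competitive h n c \<Omega> A"
    and F: "nonneg_distribution F"
  shows "ennreal c * (\<integral>\<^sup>+y. ennreal (Max ((\<lambda>i. y (Inr i)) ` {..<n})) \<partial>Pi\<^sub>M (slots h n) (\<lambda>_. F)) \<le>
    (\<integral>\<^sup>+\<omega>. (\<integral>\<^sup>+y. ennreal (payoff A \<omega> (mset (map (\<lambda>i. y (Inl i)) [0..<h])) (map (\<lambda>i. y (Inr i)) [0..<n]))
      \<partial>Pi\<^sub>M (slots h n) (\<lambda>_. F)) \<partial>\<Omega>)"
proof -
  have F: "prob_space F" "sets F = sets borel" "AE x in F. 0 \<le> x"
    using F by (auto simp: nonneg_distribution_def)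
  interpret O: prob_space \<Omega>
    using alg by (simp add: online_algorithm_def)
  interpret P: prob_space "Pi\<^sub>M (slots h n) (\<lambda>_. F)"
    using F(1) by (intro prob_space_PiM) simp
  interpret OP: pair_sigma_finite \<Omega> "Pi\<^sub>M (slots h n) (\<lambda>_. F)" ..
  define C where "C = {..<n + h}"
  have C: "finite C" "card C = n + h" by (simp_all add: C_def)
  let ?P = "Pi\<^sub>M C (\<lambda>_. F)"
  \<comment> \<open>Both gains have a history and a list as arguments, the shape of \<open>f\<close>
    in the averaging lemma. The maximum concerns arrivals alone, so \<open>{#}\<close> can stand for
    the history below.\<close>
  let ?max = "\<lambda>H xs. ennreal (Max (set xs))"
  let ?pay = "\<lambda>H xs \<omega>. ennreal (payoff A \<omega> H xs)"
  have proj: "(\<lambda>y. y j) \<in> borel_measurable (Pi\<^sub>M (slots h n) (\<lambda>_. F))" if "j \<in> slots h n" for j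
    using measurable_component_singleton[OF that, of "\<lambda>_. F"] F(2) measurable_cong_sets by blast
  have joint: "(\<lambda>(\<omega>, y). ?pay (mset (map (\<lambda>i. y (Inl i)) [0..<h])) (map (\<lambda>i. y (Inr i)) [0..<n]) \<omega>)
      \<in> borel_measurable (\<Omega> \<Otimes>\<^sub>M Pi\<^sub>M (slots h n) (\<lambda>_. F))"
    unfolding case_prod_beta
    by (intro measurable_compose[OF _ measurable_ennreal] payoff_measurable[OF alg] measurable_fst
        measurable_compose[OF measurable_snd proj]) auto
  have max_eq: "set (map (\<lambda>i. y (Inr i)) [0..<n]) = (\<lambda>i. y (Inr i)) ` {..<n}" for y :: "nat + nat \<Rightarrow> real"
    by (simp add: lessThan_atLeast0)
  have max: "(\<lambda>y. ?max (mset (map (\<lambda>i. y (Inl i)) [0..<h])) (map (\<lambda>i. y (Inr i)) [0..<n]))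
      \<in> borel_measurable (Pi\<^sub>M (slots h n) (\<lambda>_. F))"
    unfolding max_eq by (intro measurable_compose[OF _ measurable_ennreal] borel_measurable_Max proj) auto
  have pay: "(\<lambda>y. \<integral>\<^sup>+\<omega>. ?pay (mset (map (\<lambda>i. y (Inl i)) [0..<h])) (map (\<lambda>i. y (Inr i)) [0..<n]) \<omega> \<partial>\<Omega>)
      \<in> borel_measurable (Pi\<^sub>M (slots h n) (\<lambda>_. F))"
    using joint by (intro O.borel_measurable_nn_integral) (simp add: case_prod_beta measurable_pair_swap)
  have meas_max: "(\<lambda>z. \<integral>\<^sup>+(H, xs). ?max (image_mset z (mset_set H)) (map z xs) \<partial>arrival_pmf h C)
      \<in> borel_measurable ?P"
    by (rule nn_integral_average_arrival_iid(1)[OF F(1) C max])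
  \<comment> \<open>With the seed integral innermost, the seed-averaged payoff is a function of
    history and arrivals to which the averaging lemma applies.\<close>
  have swap: "(\<integral>\<^sup>+\<omega>. (\<integral>\<^sup>+(H, xs). ?pay (image_mset z (mset_set H)) (map z xs) \<omega> \<partial>arrival_pmf h C) \<partial>\<Omega>) =
      (\<integral>\<^sup>+(H, xs). (\<integral>\<^sup>+\<omega>. ?pay (image_mset z (mset_set H)) (map z xs) \<omega> \<partial>\<Omega>) \<partial>arrival_pmf h C)" for z
    unfolding case_prod_beta
  proof (rule nn_integral_pmf_swap)
    show "?pay (image_mset z (mset_set (fst a))) (map z (snd a)) \<in> borel_measurable \<Omega>"
      if "a \<in> set_pmf (arrival_pmf h C)" for a
    proof -
      have "(fst a, snd a) \<in> set_pmf (arrival_pmf h C)"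
        using that by simp
      \<comment> \<open>The slot encoding brings history and arrivals into the indexed form of
        \<open>payoff_measurable\<close>; since \<open>z\<close> is fixed, all values are constants
        and only the seed varies.\<close>
      then obtain \<sigma> where "bij_betw \<sigma> (slots h n) C"
        and \<sigma>: "mset_set (fst a) = mset (map (\<lambda>i. \<sigma> (Inl i)) [0..<h])"
        "snd a = map (\<lambda>i. \<sigma> (Inr i)) [0..<n]"
        using arrival_bij[OF C] by blast
      have eq: "image_mset z (mset_set (fst a)) = mset (map (\<lambda>i. z (\<sigma> (Inl i))) [0..<h])"
        "map z (snd a) = map (\<lambda>i. z (\<sigma> (Inr i))) [0..<n]"
        unfolding \<sigma> by (simp_all add: multiset.map_comp o_def)
      show ?thesis
        unfolding eq
        by (intro measurable_compose[OF _ measurable_ennreal] payoff_measurable[OF alg]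
            measurable_ident measurable_const) auto
    qed
  qed (use C in \<open>simp add: set_arrival_pmf\<close>)
  \<comment> \<open>\<open>F\<close> is nonnegative only almost everywhere, so \<open>z\<close>
    gives a legal secretary instance outside a finite union of null sets.\<close>
  have nonneg: "AE z in ?P. \<forall>i\<in>C. 0 \<le> z i"
    using F C by (intro AE_ball_countable[THEN iffD2] ballI AE_PiM_component) auto
  have "ennreal c * (\<integral>\<^sup>+y. ?max {#} (map (\<lambda>i. y (Inr i)) [0..<n]) \<partial>Pi\<^sub>M (slots h n) (\<lambda>_. F)) =
      ennreal c * (\<integral>\<^sup>+z. (\<integral>\<^sup>+(H, xs). ?max (image_mset z (mset_set H)) (map z xs) \<partial>arrival_pmf h C) \<partial>?P)"
    using nn_integral_average_arrival_iid(2)[OF F(1) C max] by simp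
  also have "\<dots> = (\<integral>\<^sup>+z. ennreal c *
      (\<integral>\<^sup>+(H, xs). ?max (image_mset z (mset_set H)) (map z xs) \<partial>arrival_pmf h C) \<partial>?P)"
    by (rule nn_integral_cmult[OF meas_max, symmetric])
  \<comment> \<open>The only inequality of the chain: competitiveness for the instance given by
    almost every \<open>z\<close>, integrated over \<open>z\<close>.\<close>
  also have "\<dots> \<le> (\<integral>\<^sup>+z. (\<integral>\<^sup>+\<omega>. (\<integral>\<^sup>+(H, xs).
      ?pay (image_mset z (mset_set H)) (map z xs) \<omega> \<partial>arrival_pmf h C) \<partial>\<Omega>) \<partial>?P)"
    by (rule nn_integral_mono_AE, rule eventually_mono[OF nonneg], rule ro_sp_competitiveD[OF comp C]) blast
  also have "\<dots> = (\<integral>\<^sup>+z. (\<integral>\<^sup>+(H, xs). (\<integral>\<^sup>+\<omega>.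
      ?pay (image_mset z (mset_set H)) (map z xs) \<omega> \<partial>\<Omega>) \<partial>arrival_pmf h C) \<partial>?P)"
    by (simp only: swap)
  also have "\<dots> = (\<integral>\<^sup>+y. (\<integral>\<^sup>+\<omega>. ?pay (mset (map (\<lambda>i. y (Inl i)) [0..<h])) (map (\<lambda>i. y (Inr i)) [0..<n]) \<omega>
      \<partial>\<Omega>) \<partial>Pi\<^sub>M (slots h n) (\<lambda>_. F))"
    by (rule nn_integral_average_arrival_iid(2)[OF F(1) C pay])
  \<comment> \<open>Fubini moves the seed integral back outside, the order used in
    \<open>iid_pi_alg\<close>.\<close>
  also have "\<dots> = (\<integral>\<^sup>+\<omega>. (\<integral>\<^sup>+y. ?pay (mset (map (\<lambda>i. y (Inl i)) [0..<h])) (map (\<lambda>i. y (Inr i)) [0..<n]) \<omega>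
      \<partial>Pi\<^sub>M (slots h n) (\<lambda>_. F)) \<partial>\<Omega>)"
    by (rule OP.Fubini'[OF joint])
  finally show ?thesis by (simp only: max_eq)
qed

section \<open>From an arbitrary sample space to the product measure\<close>

text \<open>Independence means that the joint law is the product of the marginals, all equal to
  \<open>F\<close>. Expectations over \<open>M\<close> thus become integrals over the canonical
  product space.\<close>

lemma iid_pi_distr:
  assumes "iid_pi_instance h n F M T X" "n \<ge> 1"
  shows "(\<lambda>z. \<lambda>j\<in>slots h n. case_sum T X j z) \<in> measurable M (Pi\<^sub>M (slots h n) (\<lambda>_. borel))"
    and "distr M (Pi\<^sub>M (slots h n) (\<lambda>_. borel)) (\<lambda>z. \<lambda>j\<in>slots h n. case_sum T X j z) =
      Pi\<^sub>M (slots h n) (\<lambda>_. F)"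
proof -
  interpret prob_space M using assms by (simp add: iid_pi_instance_def)
  have ind: "indep_vars (\<lambda>_. borel) (case_sum T X) (slots h n)"
    and F: "\<And>i. i < h \<Longrightarrow> distr M borel (T i) = F" "\<And>i. i < n \<Longrightarrow> distr M borel (X i) = F"
    using assms by (auto simp: iid_pi_instance_def)
  have rv: "\<And>j. j \<in> slots h n \<Longrightarrow> random_variable borel (case_sum T X j)"
    using ind by (auto simp: indep_vars_def)
  \<comment> \<open>The characterisation of independence by the joint law asks for a nonempty index
    set, which \<open>n \<ge> 1\<close> provides even when \<open>h = 0\<close>.\<close>
  have "Inr 0 \<in> slots h n"
    using assms(2) by (intro InrI) simp
  then have slots_ne: "slots h n \<noteq> {}" by blast
  from rv show "(\<lambda>z. \<lambda>j\<in>slots h n. case_sum T X j z) \<in> measurable M (Pi\<^sub>M (slots h n) (\<lambda>_. borel))"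
    by (intro measurable_restrict) auto
  have "distr M (Pi\<^sub>M (slots h n) (\<lambda>_. borel)) (\<lambda>z. \<lambda>j\<in>slots h n. case_sum T X j z) =
      Pi\<^sub>M (slots h n) (\<lambda>j. distr M borel (case_sum T X j))"
    using ind slots_ne by (subst indep_vars_iff_distr_eq_PiM'[symmetric]) (auto intro: rv)
  also have "\<dots> = Pi\<^sub>M (slots h n) (\<lambda>_. F)"
    using F by (intro PiM_cong) auto
  finally show "distr M (Pi\<^sub>M (slots h n) (\<lambda>_. borel)) (\<lambda>z. \<lambda>j\<in>slots h n. case_sum T X j z) =
      Pi\<^sub>M (slots h n) (\<lambda>_. F)" .
qed

theorem theorem8:
  fixes n h :: nat and c :: real and \<Omega> :: "'s measure" and ALG :: "'s player"
  assumes "n \<ge> 1"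
    and "online_algorithm h n \<Omega> ALG"
    and "ro_sp_competitive h n c \<Omega> ALG"
  shows "iid_pi_competitive TYPE('m) h n c \<Omega> ALG"
  unfolding iid_pi_competitive_def
proof (intro allI impI)
  fix F and M :: "'m measure" and T X
  assume F: "nonneg_distribution F" and I: "iid_pi_instance h n F M T X"
  let ?B = "Pi\<^sub>M (slots h n) (\<lambda>_. borel) :: (nat + nat \<Rightarrow> real) measure"
  let ?r = "\<lambda>z. \<lambda>j\<in>slots h n. case_sum T X j z"
  note r = iid_pi_distr[OF I assms(1)]
  have proj: "(\<lambda>y. y j) \<in> borel_measurable ?B" if "j \<in> slots h n" for j
    using that by (rule measurable_component_singleton)
  have T: "map (\<lambda>i. ?r z (Inl i)) [0..<h] = map (\<lambda>i. T i z) [0..<h]" for z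
    by (rule map_cong) (auto simp: InlI)
  have X: "map (\<lambda>i. ?r z (Inr i)) [0..<n] = map (\<lambda>i. X i z) [0..<n]" for z
    by (rule map_cong) (auto simp: InrI)
  have X': "(\<lambda>i. ?r z (Inr i)) ` {..<n} = (\<lambda>i. X i z) ` {..<n}" for z
    by (rule image_cong) (auto simp: InrI)
  have "iid_pi_opt n M X = (\<integral>\<^sup>+z. ennreal (Max ((\<lambda>i. ?r z (Inr i)) ` {..<n})) \<partial>M)"
    unfolding X' iid_pi_opt_def ..
  also have "\<dots> = (\<integral>\<^sup>+y. ennreal (Max ((\<lambda>i. y (Inr i)) ` {..<n})) \<partial>Pi\<^sub>M (slots h n) (\<lambda>_. F))"
    unfolding r(2)[symmetric]
    by (subst nn_integral_distr[OF r(1)])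
      (auto intro!: measurable_compose[OF _ measurable_ennreal] borel_measurable_Max proj)
  finally have opt: "iid_pi_opt n M X = \<dots>" .
  \<comment> \<open>The seed is a fixed parameter here. It must lie in \<open>space \<Omega>\<close>
    for the constant map to be measurable, and the outer integral sees only such seeds.\<close>
  have pay: "(\<integral>\<^sup>+z. ennreal (payoff ALG \<omega> (mset (map (\<lambda>i. T i z) [0..<h])) (map (\<lambda>i. X i z) [0..<n])) \<partial>M) =
      (\<integral>\<^sup>+y. ennreal (payoff ALG \<omega> (mset (map (\<lambda>i. y (Inl i)) [0..<h])) (map (\<lambda>i. y (Inr i)) [0..<n]))
        \<partial>Pi\<^sub>M (slots h n) (\<lambda>_. F))" if "\<omega> \<in> space \<Omega>" for \<omega>
  proof -
    have "(\<lambda>y. ennreal (payoff ALG \<omega> (mset (map (\<lambda>i. y (Inl i)) [0..<h])) (map (\<lambda>i. y (Inr i)) [0..<n])))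
        \<in> borel_measurable ?B"
      using that by (intro measurable_compose[OF _ measurable_ennreal] payoff_measurable[OF assms(2)]
        measurable_const proj) auto
    then have "(\<lambda>y. ennreal (payoff ALG \<omega> (mset (map (\<lambda>i. y (Inl i)) [0..<h])) (map (\<lambda>i. y (Inr i)) [0..<n])))
        \<in> borel_measurable (distr M ?B ?r)"
      by simp
    from nn_integral_distr[OF r(1) this] show ?thesis
      unfolding r(2) T X ..
  qed
  have alg: "iid_pi_alg h n M T X \<Omega> ALG =
      (\<integral>\<^sup>+\<omega>. (\<integral>\<^sup>+y. ennreal (payoff ALG \<omega> (mset (map (\<lambda>i. y (Inl i)) [0..<h])) (map (\<lambda>i. y (Inr i)) [0..<n]))
        \<partial>Pi\<^sub>M (slots h n) (\<lambda>_. F)) \<partial>\<Omega>)"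
    unfolding iid_pi_alg_def by (rule nn_integral_cong[OF pay])
  show "ennreal c * iid_pi_opt n M X \<le> iid_pi_alg h n M T X \<Omega> ALG"
    unfolding opt alg
    by (rule ro_sp_competitive_imp_iid[OF assms(2,3) F])
qed

end
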